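(* Let $X$ be a topological space. The following are equivalent: (1) $X$ is indiscrete. (2) $\mathcal{AB}(X) = \{\emptyset, X\}$.
   Context: For a subset $A$ of a topological space $X$, $\mathrm{Int}\,A$ denotes the interior and $\overline{A}$ the closure of $A$ in $X$. $A$ is semi-open if $A \subseteq \overline{\mathrm{Int}\,A}$; semi-closed if its complement is semi-open; semi-regular if it is both semi-open and semi-closed. $A$ is an $\mathcal{AB}$-set if $A = U \cap V$ with $U$ open and $V$ semi-regular; $\mathcal{AB}(X)$ is the collection of all $\mathcal{AB}$-sets in $X$. A space is indiscrete if its only open sets are $\emptyset$ and $X$. *)

theory Defs
  imports "HOL-Analysis.Analysis"
begin

definition semi_open_in :: "'a topology \<Rightarrow> 'a set \<Rightarrow> bool" where
  "semi_open_in X A \<longleftrightarrow> A \<subseteq> topspace X \<and> A \<subseteq> X closure_of (X interior_of A)"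

definition semi_closed_in :: "'a topology \<Rightarrow> 'a set \<Rightarrow> bool" where
  "semi_closed_in X A \<longleftrightarrow> A \<subseteq> topspace X \<and> semi_open_in X (topspace X - A)"

definition semi_regular_in :: "'a topology \<Rightarrow> 'a set \<Rightarrow> bool" where
  "semi_regular_in X A \<longleftrightarrow> semi_open_in X A \<and> semi_closed_in X A"

definition AB_sets :: "'a topology \<Rightarrow> 'a set set" where
  "AB_sets X = {U \<inter> V | U V. openin X U \<and> semi_regular_in X V}"

(* The carrier may be empty, in which case {} and topspace X coincide.  This notion
   differs from the library's trivial_topology, which is the topology on the empty set. *)
definition indiscrete_space :: "'a topology \<Rightarrow> bool" where
  "indiscrete_space X \<longleftrightarrow> {U. openin X U} = {{}, topspace X}"

end

theory Submission
  imports Defs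
begin

text \<open>The whole space is semi-regular, so each open \<open>U\<close>, being
  \<open>U \<inter> topspace X\<close>, is an AB-set (\<open>openin_imp_AB_sets\<close>); if the
  only AB-sets are trivial, so are the open sets. Conversely, indiscreteness leaves only trivial
  semi-open sets (\<open>semi_open_in_indiscrete_space\<close>), and trivial sets intersect in
  trivial sets.\<close>

lemma semi_regular_in_topspace: "semi_regular_in X (topspace X)"
  by (simp add: semi_regular_in_def semi_closed_in_def semi_open_in_def)

lemma openin_imp_AB_sets: "openin X U \<Longrightarrow> U \<in> AB_sets X"
  unfolding AB_sets_def using semi_regular_in_topspace[of X] openin_subset[of X U] by blast

text \<open>The interior is open, hence trivial. If it is empty, so is its closure, which contains
  \<open>A\<close>; if it is the whole space, it lies inside \<open>A\<close>.\<close>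

lemma semi_open_in_indiscrete_space:
  assumes "indiscrete_space X" "semi_open_in X A"
  shows "A = {} \<or> A = topspace X"
proof -
  have "X interior_of A \<in> {{}, topspace X}"
    using assms(1) openin_interior_of[of X A] unfolding indiscrete_space_def by blast
  then show ?thesis
    using assms(2) interior_of_subset[of X A] by (auto simp: semi_open_in_def)
qed

theorem theorem3p4:
  fixes X :: "'a topology"
  shows "indiscrete_space X \<longleftrightarrow> AB_sets X = {{}, topspace X}"
proof
  assume X: "indiscrete_space X"
  have "W = {} \<or> W = topspace X" if W: "W \<in> AB_sets X" for W
  proof -
    obtain U V where "W = U \<inter> V" "openin X U" "semi_open_in X V"
      using W unfolding AB_sets_def semi_regular_in_def by blast
    moreover have "U = {} \<or> U = topspace X"
      using X \<open>openin X U\<close> unfolding indiscrete_space_def by blast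
    moreover have "V = {} \<or> V = topspace X"
      using semi_open_in_indiscrete_space[OF X \<open>semi_open_in X V\<close>] .
    ultimately show ?thesis by auto
  qed
  \<comment> \<open>For the reverse inclusion, both trivial sets are AB-sets because they are
    open.\<close>
  then show "AB_sets X = {{}, topspace X}"
    using openin_imp_AB_sets[OF openin_empty] openin_imp_AB_sets[OF openin_topspace] by blast
next
  assume "AB_sets X = {{}, topspace X}"
  then show "indiscrete_space X"
    unfolding indiscrete_space_def using openin_imp_AB_sets[of X] by auto
qed

end
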